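(* Let $a,b,c\in\mathbb{R}$. The element $X=aE+bH+cF\in\mathfrak{sl}(2,\mathbb{R})$ generates a knotted subgroup of $SL(2,\mathbb{R})$ if and only if $a^2+b^2<c^2$.
   Context: $\mathfrak{sl}(2,\mathbb{R})$ is the Lie algebra of traceless real $2\times2$ matrices, with basis $H=\begin{pmatrix}1&0\\0&-1\end{pmatrix}$, $E=\begin{pmatrix}0&1\\1&0\end{pmatrix}$, $F=\begin{pmatrix}0&-1\\1&0\end{pmatrix}$. A subgroup $K$ of a Lie group $G$ is knotted if there is a continuous injective group homomorphism $\gamma:S^1\to G$ with continuous inverse (defined on the image) such that $\gamma(S^1)=K$. An element $X$ of the Lie algebra of $G$ generates a knotted subgroup of $G$ if the one-parameter subgroup $\phi(t)=e^{tX}$, $t\in\mathbb{R}$, is nontrivial and non-injective (so that its image is a knotted subgroup of $G$). *)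

theory Defs
  imports "HOL-Analysis.Analysis"
begin

(* The class operations times and power on real^'n^'n are componentwise, and exp is not
   available at this type, so powers and the exponential are built from the matrix product. *)
primrec matrix_power :: "real^'n^'n \<Rightarrow> nat \<Rightarrow> real^'n^'n" where
  "matrix_power A 0 = mat 1"
| "matrix_power A (Suc k) = A ** matrix_power A k"

definition matrix_exp :: "real^'n^'n \<Rightarrow> real^'n^'n" where
  "matrix_exp A = (\<Sum>k. matrix_power A k /\<^sub>R fact k)"

(* The Lie algebra of a closed linear group G, realized inside the matrices;
   for G = SL2 these are the traceless matrices. *)
definition lie_algebra :: "(real^'n^'n) set \<Rightarrow> (real^'n^'n) set" where
  "lie_algebra G = {X. \<forall>t::real. matrix_exp (t *\<^sub>R X) \<in> G}"

definition one_param :: "real^'n^'n \<Rightarrow> real \<Rightarrow> real^'n^'n" where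
  "one_param X t = matrix_exp (t *\<^sub>R X)"

(* The one-parameter subgroup is neither trivial nor injective; its image is then a
   topologically embedded copy of the circle group in G. *)
definition generates_knotted_subgroup :: "(real^'n^'n) set \<Rightarrow> real^'n^'n \<Rightarrow> bool" where
  "generates_knotted_subgroup G X \<longleftrightarrow>
     X \<in> lie_algebra G \<and> (\<exists>t. one_param X t \<noteq> mat 1) \<and> \<not> inj (one_param X)"

definition SL2 :: "(real^2^2) set" where
  "SL2 = {A. det A = 1}"

definition matH :: "real^2^2" where
  "matH = vector [vector [1, 0], vector [0, -1]]"

definition matE :: "real^2^2" where
  "matE = vector [vector [0, 1], vector [1, 0]]"

definition matF :: "real^2^2" where
  "matF = vector [vector [0, -1], vector [1, 0]]"

end

theory Submission
  imports Defs
begin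

text \<open>
  The matrix \<open>X = aE + bH + cF\<close> squares to the scalar matrix \<open>d I\<close> with \<open>d = a\<^sup>2 + b\<^sup>2 - c\<^sup>2\<close>, by
  Cayley--Hamilton. Splitting the exponential series into even and odd powers therefore gives
  \<open>exp (t X) = C(t) I + S(t) X\<close> with scalar functions \<open>C\<close>, \<open>S\<close> that depend only on \<open>d\<close>:
  trigonometric for \<open>d < 0\<close>, hyperbolic for \<open>d > 0\<close>, and \<open>C = 1\<close>, \<open>S(t) = t\<close> for \<open>d = 0\<close>
  (\<open>matrix_exp_elliptic\<close>, \<open>matrix_exp_hyperbolic\<close>, \<open>matrix_exp_parabolic\<close>).

  In the elliptic case, with \<open>d = - w\<^sup>2\<close>, the one-parameter group is periodic: it takes the value
  \<open>-I\<close> at \<open>\<pi> / w\<close> and returns to \<open>I\<close> at \<open>2 \<pi> / w\<close>; it stays in \<open>SL(2,\<real>)\<close> because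
  \<open>det (C I + S X) = C\<^sup>2 - d S\<^sup>2 = cos\<^sup>2 + sin\<^sup>2\<close>. In the other two cases, \<open>X\<close> being traceless, the
  scalar part and the \<open>X\<close> part of \<open>exp (t X)\<close> are independent unless \<open>X = 0\<close>, so the injective
  coefficient \<open>S\<close> makes the one-parameter group injective; for \<open>X = 0\<close> it is trivial.
\<close>

lemma matrix_power_square_scalar:
  fixes X :: "real^'n^'n"
  assumes "X ** X = d *\<^sub>R mat 1"
  shows "matrix_power (t *\<^sub>R X) k =
    (t ^ k * d ^ (k div 2)) *\<^sub>R (if even k then mat 1 else X)"
proof (induction k)
  case 0
  then show ?case by simp
next
  case (Suc k)
  then show ?case
    by (auto simp: assms matrix_scalar_ac algebra_simps simp flip: scalar_matrix_assoc
        elim!: evenE oddE)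
qed

text \<open>
  The two hypotheses say that \<open>C\<close> and \<open>S\<close> are \<open>cosh (t \<surd>d)\<close> and \<open>sinh (t \<surd>d) / \<surd>d\<close>, written as
  power series in \<open>t\<close> whose coefficients are polynomials in \<open>d\<close>, so that they make sense for every
  real \<open>d\<close>, zero and negative values included.
\<close>

lemma matrix_exp_square_scalar:
  fixes X :: "real^'n^'n"
  assumes sq: "X ** X = d *\<^sub>R mat 1"
    and C: "(\<lambda>k. if even k then t ^ k * d ^ (k div 2) / fact k else 0) sums C"
    and S: "(\<lambda>k. if even k then 0 else t ^ k * d ^ (k div 2) / fact k) sums S"
  shows "matrix_exp (t *\<^sub>R X) = C *\<^sub>R mat 1 + S *\<^sub>R X"
proof -
  have "(\<lambda>k. (if even k then t ^ k * d ^ (k div 2) / fact k else 0) *\<^sub>R mat 1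
      + (if even k then 0 else t ^ k * d ^ (k div 2) / fact k) *\<^sub>R X)
      sums (C *\<^sub>R mat 1 + S *\<^sub>R X)"
    by (intro sums_add sums_scaleR_left C S)
  also have "(\<lambda>k. (if even k then t ^ k * d ^ (k div 2) / fact k else 0) *\<^sub>R mat 1
      + (if even k then 0 else t ^ k * d ^ (k div 2) / fact k) *\<^sub>R X)
      = (\<lambda>k. matrix_power (t *\<^sub>R X) k /\<^sub>R fact k)"
    by (rule ext) (simp add: matrix_power_square_scalar[OF sq] field_simps)
  finally show ?thesis
    unfolding matrix_exp_def by (rule sums_unique[symmetric])
qed

lemma matrix_exp_elliptic:
  fixes X :: "real^'n^'n"
  assumes "X ** X = (- w\<^sup>2) *\<^sub>R mat 1" "w \<noteq> 0"
  shows "matrix_exp (t *\<^sub>R X) = cos (w * t) *\<^sub>R mat 1 + (sin (w * t) / w) *\<^sub>R X"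
proof (rule matrix_exp_square_scalar[OF assms(1)])
  have "cos_coeff k *\<^sub>R (w * t) ^ k = (if even k then t ^ k * (- w\<^sup>2) ^ (k div 2) / fact k else 0)"
    for k
    by (auto simp: cos_coeff_def power_mult_distrib power_mult power_minus[of "w\<^sup>2"] elim!: evenE)
  then show "(\<lambda>k. if even k then t ^ k * (- w\<^sup>2) ^ (k div 2) / fact k else 0) sums cos (w * t)"
    using cos_converges[of "w * t"] by simp
  have "sin_coeff k *\<^sub>R (w * t) ^ k / w =
      (if even k then 0 else t ^ k * (- w\<^sup>2) ^ (k div 2) / fact k)" for k
    using assms(2)
    by (auto simp: sin_coeff_def power_mult_distrib power_mult power_minus[of "w\<^sup>2"] elim!: oddE)
  then show "(\<lambda>k. if even k then 0 else t ^ k * (- w\<^sup>2) ^ (k div 2) / fact k) sums (sin (w * t) / w)"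
    using sums_divide[OF sin_converges[of "w * t"], of w] by simp
qed

lemma matrix_exp_hyperbolic:
  fixes X :: "real^'n^'n"
  assumes "X ** X = w\<^sup>2 *\<^sub>R mat 1" "w \<noteq> 0"
  shows "matrix_exp (t *\<^sub>R X) = cosh (w * t) *\<^sub>R mat 1 + (sinh (w * t) / w) *\<^sub>R X"
proof (rule matrix_exp_square_scalar[OF assms(1)])
  have "(if even k then (w * t) ^ k /\<^sub>R fact k else 0) =
      (if even k then t ^ k * (w\<^sup>2) ^ (k div 2) / fact k else 0)" for k
    by (auto simp: power_mult_distrib power_mult divide_inverse elim!: evenE)
  then show "(\<lambda>k. if even k then t ^ k * (w\<^sup>2) ^ (k div 2) / fact k else 0) sums cosh (w * t)"
    using cosh_converges[of "w * t"] by simp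
  have "(if even k then 0 else (w * t) ^ k /\<^sub>R fact k) / w =
      (if even k then 0 else t ^ k * (w\<^sup>2) ^ (k div 2) / fact k)" for k
    using assms(2) by (auto simp: power_mult_distrib power_mult divide_inverse elim!: oddE)
  then show "(\<lambda>k. if even k then 0 else t ^ k * (w\<^sup>2) ^ (k div 2) / fact k) sums (sinh (w * t) / w)"
    using sums_divide[OF sinh_converges[of "w * t"], of w] by simp
qed

lemma matrix_exp_parabolic:
  fixes X :: "real^'n^'n"
  assumes "X ** X = 0"
  shows "matrix_exp (t *\<^sub>R X) = mat 1 + t *\<^sub>R X"
proof -
  have "matrix_exp (t *\<^sub>R X) = 1 *\<^sub>R mat 1 + t *\<^sub>R X"
  proof (rule matrix_exp_square_scalar)
    show "X ** X = 0 *\<^sub>R mat 1"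
      using assms by simp
    have "(if even k then t ^ k * 0 ^ (k div 2) / fact k else 0) = (if k = 0 then 1 else 0)" for k
      by (auto elim!: evenE)
    then show "(\<lambda>k. if even k then t ^ k * 0 ^ (k div 2) / fact k else 0) sums 1"
      using sums_single[of 0 "\<lambda>_. 1 :: real"] by simp
    have "(if even k then 0 else t ^ k * 0 ^ (k div 2) / fact k) = (if k = 1 then t else 0)" for k
      by (auto elim!: oddE)
    then show "(\<lambda>k. if even k then 0 else t ^ k * 0 ^ (k div 2) / fact k) sums t"
      using sums_single[of 1 "\<lambda>_. t"] by simp
  qed
  then show ?thesis by simp
qed

lemma traceless_square:
  fixes X :: "real^2^2"
  assumes "trace X = 0"
  shows "X ** X = (- det X) *\<^sub>R mat 1"
proof -
  have "X $ 2 $ 2 = - X $ 1 $ 1"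
    using assms by (simp add: trace_def sum_2)
  then show ?thesis
    by (simp add: vec_eq_iff forall_2 matrix_matrix_mult_def sum_2 mat_def det_2 algebra_simps)
qed

lemma det_scalar_plus_traceless:
  fixes X :: "real^2^2"
  assumes "trace X = 0"
  shows "det (x *\<^sub>R mat 1 + y *\<^sub>R X) = x\<^sup>2 + y\<^sup>2 * det X"
proof -
  have "X $ 2 $ 2 = - X $ 1 $ 1"
    using assms by (simp add: trace_def sum_2)
  then show ?thesis
    by (simp add: det_2 mat_def power2_eq_square algebra_simps)
qed

text \<open>Taking traces removes \<open>X\<close> and so compares the scalar parts.\<close>

lemma scalar_plus_traceless_eqD:
  fixes X :: "real^2^2"
  assumes "trace X = 0" "X \<noteq> 0"
    and eq: "x *\<^sub>R mat 1 + y *\<^sub>R X = x' *\<^sub>R mat 1 + y' *\<^sub>R X"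
  shows "y = y'"
proof -
  have "trace (z *\<^sub>R mat 1 + u *\<^sub>R X) = 2 * z" for z u
    using assms(1) by (simp add: trace_def sum_2 mat_def) (simp add: distrib_left[symmetric])
  then have "x = x'"
    using arg_cong[OF eq, of trace] by simp
  then show ?thesis
    using eq assms(2) by simp
qed

lemma one_param_inj_if_det_nonpos:
  fixes X :: "real^2^2"
  assumes tr: "trace X = 0" and "X \<noteq> 0" and "det X \<le> 0"
  shows "inj (one_param X)"
proof (cases "det X = 0")
  case True
  then have "X ** X = 0"
    using traceless_square[OF tr] by simp
  then have "one_param X t = 1 *\<^sub>R mat 1 + t *\<^sub>R X" for t
    by (simp add: one_param_def matrix_exp_parabolic)
  then show ?thesis
    by (metis injI scalar_plus_traceless_eqD[OF tr \<open>X \<noteq> 0\<close>])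
next
  case False
  define w where "w = sqrt (- det X)"
  have w: "w \<noteq> 0" "w\<^sup>2 = - det X"
    using False assms(3) by (auto simp: w_def)
  then have "X ** X = w\<^sup>2 *\<^sub>R mat 1"
    using traceless_square[OF tr] by simp
  then have exp_eq: "one_param X t = cosh (w * t) *\<^sub>R mat 1 + (sinh (w * t) / w) *\<^sub>R X" for t
    using w by (simp add: one_param_def matrix_exp_hyperbolic)
  show ?thesis
  proof (rule injI)
    fix s t
    assume "one_param X s = one_param X t"
    then have "sinh (w * s) / w = sinh (w * t) / w"
      unfolding exp_eq by (rule scalar_plus_traceless_eqD[OF tr \<open>X \<noteq> 0\<close>])
    then show "s = t"
      using w by simp
  qed
qed

lemma generates_knotted_subgroup_SL2_iff:
  fixes X :: "real^2^2"
  assumes tr: "trace X = 0"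
  shows "generates_knotted_subgroup SL2 X \<longleftrightarrow> 0 < det X"
proof
  assume knotted: "generates_knotted_subgroup SL2 X"
  have "X \<noteq> 0"
  proof
    assume "X = 0"
    then have "one_param X t = mat 1" for t
      using matrix_exp_parabolic[of X t] by (simp add: one_param_def)
    then show False
      using knotted by (simp add: generates_knotted_subgroup_def)
  qed
  then show "0 < det X"
    using knotted one_param_inj_if_det_nonpos[OF tr]
    by (fastforce simp: generates_knotted_subgroup_def)
next
  assume pos: "0 < det X"
  define w where "w = sqrt (det X)"
  have w: "w \<noteq> 0" "w\<^sup>2 = det X"
    using pos by (auto simp: w_def)
  then have "X ** X = (- w\<^sup>2) *\<^sub>R mat 1"
    using traceless_square[OF tr] by simp
  then have exp_eq: "matrix_exp (t *\<^sub>R X) = cos (w * t) *\<^sub>R mat 1 + (sin (w * t) / w) *\<^sub>R X" for t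
    using w by (simp add: matrix_exp_elliptic)
  have "det (matrix_exp (t *\<^sub>R X)) = 1" for t
    using w by (simp add: exp_eq det_scalar_plus_traceless[OF tr] power_divide
        flip: w(2))
  then have "X \<in> lie_algebra SL2"
    by (simp add: lie_algebra_def SL2_def)
  moreover have "one_param X (pi / w) \<noteq> mat 1"
    using w by (simp add: one_param_def exp_eq vec_eq_iff mat_def)
  moreover have "one_param X (2 * pi / w) = one_param X 0"
    unfolding one_param_def exp_eq using w by simp
  then have "\<not> inj (one_param X)"
    using w by (auto dest!: injD)
  ultimately show "generates_knotted_subgroup SL2 X"
    by (auto simp: generates_knotted_subgroup_def)
qed

theorem theorem13:
  fixes a b c :: real
  shows "generates_knotted_subgroup SL2 (a *\<^sub>R matE + b *\<^sub>R matH + c *\<^sub>R matF)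
           \<longleftrightarrow> a\<^sup>2 + b\<^sup>2 < c\<^sup>2"
proof -
  let ?X = "a *\<^sub>R matE + b *\<^sub>R matH + c *\<^sub>R matF"
  have "trace ?X = 0"
    by (simp add: trace_def sum_2 matE_def matH_def matF_def)
  moreover have "det ?X = c\<^sup>2 - a\<^sup>2 - b\<^sup>2"
    by (simp add: det_2 matE_def matH_def matF_def power2_eq_square algebra_simps)
  ultimately show ?thesis
    by (simp add: generates_knotted_subgroup_SL2_iff) linarith
qed

end
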